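(* Let $(Y, d_Y)$ be a metric space. For all $k \in \mathbb{N}$ (with $k \ge 1$), let $H_k \colon [0,1] \times Y \to Y$ be an isotopy, and let $V_k \subseteq Y$ be such that $H_k$ is the identity on $[0,1] \times V_k^c$, i.e. $H_k(t,y) = y$ for all $t \in [0,1]$ and $y \in Y \setminus V_k$. For each $k$ define $h_k \colon Y \to Y$ by $h_k(y) = H_k(1,y)$ (a homeomorphism), and for all $n \in \mathbb{N}$ define $\mathscr{h}_n = h_n \circ h_{n-1} \circ \cdots \circ h_1$. Let $\mathscr{h}_0$ be the identity on $Y$. Suppose that (1) $\lim_{n\to\infty} \operatorname{diam}\bigl(\bigcup_{k=n}^\infty V_k\bigr) = 0$; (2) there exists a compact set $A \subseteq Y$ such that $\bigcup_{k=1}^\infty V_k \subseteq A^\circ$; (3) the (pointwise) limit $\mathscr{h}_\infty = \lim_{n\to\infty} \mathscr{h}_n \colon Y \to Y$ exists and is bijective. Let $t_0 = 0$ and let $(t_k)_{k=1}^\infty$ be a strictly increasing sequence in $(0,1)$ converging to $1$. Then the function $\mathscr{H}_\infty \colon [0,1] \times Y \to Y$ defined by $$\mathscr{H}_\infty(t,y) = \begin{cases} H_1\bigl(\tfrac{t-t_0}{t_1-t_0},\, y\bigr) & \text{if } t \in [t_0,t_1],\\[4pt] H_k\bigl(\tfrac{t-t_{k-1}}{t_k-t_{k-1}},\, \mathscr{h}_{k-1}(y)\bigr) & \text{if } t \in (t_{k-1},t_k],\ k \ge 2,\\[4pt] \mathscr{h}_\infty(y) & \text{if } t = 1, \end{cases}$$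 is an isotopy.
   Context: An isotopy (of $Y$) is a function $H \colon [0,1]\times Y \to Y$ such that (i) $H$ is continuous; (ii) $H(0,\cdot)$ is the identity on $Y$; and (iii) for every $t \in [0,1]$, the function $H(t,\cdot) \colon Y \to Y$ is a homeomorphism. $A^\circ$ denotes the interior of $A$ in $Y$, and $\operatorname{diam}$ denotes the diameter of a subset of $Y$ with respect to $d_Y$. The symbols $\mathscr{h}_n$, $\mathscr{h}_\infty$, $\mathscr{H}_\infty$ are just names for the maps defined in the claim. *)

theory Defs
  imports "HOL-Analysis.Analysis"
begin

text \<open>
  The metric space \<open>Y\<close> is the whole carrier of the type \<open>'a\<close>. The domain \<open>[0,1] \<times> Y\<close> is the set
  \<open>{0..1} \<times> UNIV\<close>; values of \<open>H\<close> outside it are irrelevant.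
\<close>

definition isotopy :: "(real \<times> 'a \<Rightarrow> 'a::topological_space) \<Rightarrow> bool" where
  "isotopy H \<longleftrightarrow>
     continuous_on ({0..1} \<times> UNIV) H \<and>
     (\<forall>y. H (0, y) = y) \<and>
     (\<forall>t\<in>{0..1}. \<exists>g. homeomorphism UNIV UNIV (\<lambda>y. H (t, y)) g)"

definition end_map :: "(real \<times> 'a \<Rightarrow> 'a) \<Rightarrow> 'a \<Rightarrow> 'a" where
  "end_map H y = H (1, y)"

text \<open>The index of the sequence \<open>H\<close> starts at \<open>1\<close>; \<open>H 0\<close> is never used.\<close>

primrec iterated_comp :: "(nat \<Rightarrow> real \<times> 'a \<Rightarrow> 'a) \<Rightarrow> nat \<Rightarrow> 'a \<Rightarrow> 'a" where
  "iterated_comp H 0 = id"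
| "iterated_comp H (Suc n) = end_map (H (Suc n)) \<circ> iterated_comp H n"

text \<open>
  For \<open>s \<in> (t\<^sub>1, 1)\<close> the index \<open>k \<ge> 2\<close> with \<open>s \<in> (t\<^sub>k\<^sub>-\<^sub>1, t\<^sub>k]\<close> is unique when \<open>t\<close> increases strictly
  to \<open>1\<close>; the lemmas below recover the defining equations of the three cases.
\<close>

definition infinite_concat ::
    "(nat \<Rightarrow> real) \<Rightarrow> (nat \<Rightarrow> real \<times> 'a \<Rightarrow> 'a) \<Rightarrow> ('a \<Rightarrow> 'a) \<Rightarrow> real \<times> 'a \<Rightarrow> 'a" where
  "infinite_concat t H h_inf = (\<lambda>(s, y).
     if s = 1 then h_inf y
     else if s \<in> {t 0..t 1} then H 1 ((s - t 0) / (t 1 - t 0), y)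
     else (let k = (THE k. k \<ge> 2 \<and> s \<in> {t (k - 1)<..t k})
           in H k ((s - t (k - 1)) / (t k - t (k - 1)), iterated_comp H (k - 1) y)))"

lemma infinite_concat_end: "infinite_concat t H h_inf (1, y) = h_inf y"
  by (simp add: infinite_concat_def)

lemma infinite_concat_first:
  assumes "t 1 < 1" and "s \<in> {t 0..t 1}"
  shows "infinite_concat t H h_inf (s, y) = H 1 ((s - t 0) / (t 1 - t 0), y)"
  using assms by (auto simp: infinite_concat_def)

lemma infinite_concat_later:
  assumes mono: "strict_mono_on {1..} t" and less: "\<And>k. k \<ge> 1 \<Longrightarrow> t k < 1"
    and k: "k \<ge> 2" "s \<in> {t (k - 1)<..t k}"
  shows "infinite_concat t H h_inf (s, y) =
    H k ((s - t (k - 1)) / (t k - t (k - 1)), iterated_comp H (k - 1) y)"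
proof -
  have le: "t i \<le> t j" if "1 \<le> i" "i \<le> j" for i j
    using strict_mono_onD[OF mono, of i j] that by (cases "i = j") auto
  have "(THE k. k \<ge> 2 \<and> s \<in> {t (k - 1)<..t k}) = k"
  proof (rule the_equality)
    fix j assume j: "j \<ge> 2 \<and> s \<in> {t (j - 1)<..t j}"
    show "j = k"
    proof (rule ccontr)
      assume "j \<noteq> k"
      then consider "j \<le> k - 1" | "k \<le> j - 1" by linarith
      then show False
        using le[of j "k - 1"] le[of k "j - 1"] j k by cases auto
    qed
  qed (use k in auto)
  moreover have "s \<noteq> 1" "\<not> s \<le> t 1"
  proof -
    have "1 \<le> k - 1" using k by simp
    then have "t 1 \<le> t (k - 1)" using le[of 1 "k - 1"] by blast
    then show "s \<noteq> 1" "\<not> s \<le> t 1" using less[of k] k by auto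
  qed
  ultimately show ?thesis by (simp add: infinite_concat_def Let_def)
qed

end

theory Submission
  imports Defs
begin

text \<open>
  Write \<open>F\<close> for the concatenation and \<open>h\<^sub>n\<close> for the \<open>n\<close>-fold composition. Since \<open>F (t n, y) = h\<^sub>n y\<close>,
  the map \<open>(s, y) \<mapsto> F (min s (t n), y)\<close> is \<open>F\<close> stopped at time \<open>t n\<close>. It is continuous, because only
  finitely many isotopies are glued before \<open>t n\<close>. A bijection that is the identity off \<open>V\<close> maps \<open>V\<close> to
  itself; so after time \<open>t n\<close> a point either never moves again or stays in the union of the sets
  \<open>V k\<close> with \<open>k > n\<close>, and hence the stopped map is within the diameter of this union of \<open>F\<close>. These diameters
  tend to \<open>0\<close>, so \<open>F\<close> is a uniform limit of continuous maps and is continuous, also at time \<open>1\<close>.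

  At times before \<open>1\<close> the map \<open>F (s, _)\<close> is a composition of finitely many homeomorphisms. At time \<open>1\<close> it is
  the continuous bijection \<open>h_inf\<close>, which is the identity off the interior of the compact set \<open>A\<close>. Its
  inverse is continuous on \<open>A\<close> by compactness and is the identity on the complement of the interior of
  \<open>A\<close>; these two closed sets cover the space.
\<close>

section \<open>Bijections supported in a set\<close>

lemma bij_fixing_complement_preserves:
  assumes "bij f" and "\<And>y. y \<notin> V \<Longrightarrow> f y = y" and "x \<in> V"
  shows "f x \<in> V"
  using assms by (metis bij_is_inj injD)

text \<open>
  A continuous bijection of a compact set onto itself has a continuous inverse; outside the set the
  inverse is the identity. The \<^emph>\<open>interior\<close> in the hypothesis makes both pieces closed, so that the two
  continuity statements can be glued.
\<close>

lemma homeomorphism_if_identity_off_compact: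
  fixes f :: "'a::t2_space \<Rightarrow> 'a"
  assumes cont: "continuous_on UNIV f" and bij: "bij f" and A: "compact A"
    and id: "\<And>y. y \<notin> interior A \<Longrightarrow> f y = y"
  shows "homeomorphism UNIV UNIV f (inv f)"
proof -
  have left: "inv f (f y) = y" and right: "f (inv f y) = y" for y
    using bij by (simp_all add: bij_is_inj bij_is_surj surj_f_inv_f)
  have "f ` A = A"
  proof
    show "f ` A \<subseteq> A"
      using bij_fixing_complement_preserves[OF bij, of A] id interior_subset[of A] by blast
    have "inv f y \<in> A" if "y \<in> A" for y
      using id[of "inv f y"] right[of y] that interior_subset[of A] by fastforce
    then show "A \<subseteq> f ` A"
      using right by (metis imageI subsetI)
  qed
  moreover have "continuous_on (f ` A) (inv f)"
    using left by (intro continuous_on_inv continuous_on_subset[OF cont] A) auto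
  ultimately have onA: "continuous_on A (inv f)" by simp
  have "inv f y = y" if "y \<in> - interior A" for y
    using left[of y] id[of y] that by simp
  then have "continuous_on (- interior A) (inv f)"
    by (metis (no_types, lifting) continuous_on_cong continuous_on_id)
  with onA have "continuous_on (A \<union> - interior A) (inv f)"
    using compact_imp_closed[OF A] by (intro continuous_on_closed_Un) auto
  moreover have "A \<union> - interior A = UNIV"
    using interior_subset by blast
  ultimately show ?thesis
    using cont left right bij by (simp add: homeomorphism_def bij_is_surj bij_imp_bij_inv)
qed

section \<open>Finite compositions of isotopies\<close>

lemma isotopy_bij:
  assumes "isotopy H" and "s \<in> {0..1}"
  shows "bij (\<lambda>y. H (s, y))"
proof -
  obtain g where "homeomorphism UNIV UNIV (\<lambda>y. H (s, y)) g"
    using assms unfolding isotopy_def by blast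
  then show ?thesis
    by (intro o_bij[of g]) (auto simp: homeomorphism_def fun_eq_iff)
qed

lemma isotopy_preserves_support:
  assumes "isotopy H" and "\<And>s y. s \<in> {0..1} \<Longrightarrow> y \<notin> V \<Longrightarrow> H (s, y) = y"
    and "s \<in> {0..1}" and "x \<in> V"
  shows "H (s, x) \<in> V"
  using bij_fixing_complement_preserves[OF isotopy_bij[OF assms(1,3)]] assms by blast

lemma iterated_comp_homeomorphism:
  assumes "\<And>k. k \<ge> 1 \<Longrightarrow> isotopy (H k)"
  shows "\<exists>g. homeomorphism UNIV UNIV (iterated_comp H n) g"
proof (induction n)
  case 0
  show ?case
    by (auto simp: id_def intro!: exI[of _ "\<lambda>x. x"] homeomorphism_ident)
next
  case (Suc n)
  have "\<exists>g. homeomorphism UNIV UNIV (end_map (H (Suc n))) g"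
    using assms[of "Suc n"] unfolding isotopy_def end_map_def[abs_def] by simp
  with Suc show ?case
    using homeomorphism_compose by (metis iterated_comp.simps(2))
qed

text \<open>
  Each later isotopy either fixes the current position or keeps it inside its own support. So once the
  position meets a later support it is confined to their union, which bounds the total later displacement by
  the diameter of that union. The time \<open>s\<close> covers the positions in the middle of an isotopy as well.
\<close>

lemma later_motion_trapped:
  fixes V :: "nat \<Rightarrow> 'a::topological_space set"
  assumes iso: "\<And>k. k \<ge> 1 \<Longrightarrow> isotopy (H k)"
    and supp: "\<And>k s y. k \<ge> 1 \<Longrightarrow> s \<in> {0..1} \<Longrightarrow> y \<notin> V k \<Longrightarrow> H k (s, y) = y"
    and "n \<le> m" and s: "s \<in> {0..1}"
  defines "W \<equiv> (\<Union>k\<in>{Suc n..}. V k)"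
  shows "H (Suc m) (s, iterated_comp H m y) = iterated_comp H n y \<or>
    H (Suc m) (s, iterated_comp H m y) \<in> W \<and> iterated_comp H n y \<in> W"
proof -
  let ?stay = "\<lambda>a. a = iterated_comp H n y \<or> a \<in> W \<and> iterated_comp H n y \<in> W"
  have stay: "?stay (H (Suc k) (r, a))" if "n \<le> k" "r \<in> {0..1}" "?stay a" for k r a
  proof (cases "a \<in> V (Suc k)")
    case True
    then have "H (Suc k) (r, a) \<in> V (Suc k)"
      using isotopy_preserves_support[of "H (Suc k)" "V (Suc k)"] iso[of "Suc k"] supp[of "Suc k"]
        that by simp
    moreover have "V (Suc k) \<subseteq> W"
      unfolding W_def using that by auto
    ultimately show ?thesis
      using True that by blast
  next
    case False
    then show ?thesis
      using supp[of "Suc k" r a] that by simp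
  qed
  have "?stay (iterated_comp H m y)"
    using \<open>n \<le> m\<close>
  proof (induction m rule: dec_induct)
    case (step k)
    then show ?case
      using stay[of k 1 "iterated_comp H k y"]
      by (simp add: end_map_def)
  qed simp
  with stay[OF \<open>n \<le> m\<close> s] show ?thesis .
qed

section \<open>The infinite concatenation\<close>

locale isotopy_sequence =
  fixes H :: "nat \<Rightarrow> real \<times> 'a \<Rightarrow> 'a::metric_space"
    and V :: "nat \<Rightarrow> 'a set"
    and h_inf :: "'a \<Rightarrow> 'a"
    and t :: "nat \<Rightarrow> real"
    and A :: "'a set"
  assumes iso: "\<And>k. k \<ge> 1 \<Longrightarrow> isotopy (H k)"
    and supp: "\<And>k s y. k \<ge> 1 \<Longrightarrow> s \<in> {0..1} \<Longrightarrow> y \<notin> V k \<Longrightarrow> H k (s, y) = y"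
    and diam: "(\<lambda>n. diameter (\<Union>k\<in>{n..}. V k)) \<longlonglongrightarrow> 0"
    and compact: "compact A" and V_A: "(\<Union>k\<in>{1..}. V k) \<subseteq> interior A"
    and lim: "\<And>y. (\<lambda>n. iterated_comp H n y) \<longlonglongrightarrow> h_inf y"
    and bij: "bij h_inf"
    and t0: "t 0 = 0"
    and t_mono_on: "strict_mono_on {1..} t"
    and t_range: "\<And>k. k \<ge> 1 \<Longrightarrow> t k \<in> {0<..<1}"
    and t_lim: "t \<longlonglongrightarrow> 1"
begin

abbreviation F :: "real \<times> 'a \<Rightarrow> 'a" where
  "F \<equiv> infinite_concat t H h_inf"

abbreviation stage_time :: "nat \<Rightarrow> real \<Rightarrow> real" where
  "stage_time n s \<equiv> (s - t n) / (t (Suc n) - t n)"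

lemma t_strict_mono: "strict_mono t"
proof (rule strict_monoI_Suc)
  fix n
  show "t n < t (Suc n)"
    using t0 t_range[of 1] strict_mono_onD[OF t_mono_on, of n "Suc n"] by (cases n) auto
qed

lemma t_less_1: "t n < 1" and t_nonneg: "0 \<le> t n"
  using t_range[of n] t0 by (cases n; simp)+

lemma stage_time_range:
  assumes "s \<in> {t n..t (Suc n)}"
  shows "stage_time n s \<in> {0..1}"
  using assms strict_monoD[OF t_strict_mono, of n "Suc n"] by (auto simp: divide_simps)

text \<open>
  The stages may be taken closed on the left: at \<open>s = t n\<close> both neighbouring stages give \<open>h\<^sub>n\<close>. This makes
  consecutive stages overlap in closed sets, as needed for gluing.
\<close>

lemma F_stage:
  assumes "s \<in> {t n..t (Suc n)}"
  shows "F (s, y) = H (Suc n) (stage_time n s, iterated_comp H n y)"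
proof (cases n)
  case 0
  then show ?thesis
    using infinite_concat_first[of t s H h_inf y] assms t_less_1[of 1] by simp
next
  case (Suc m)
  have later: "F (r, y) = H (Suc k) (stage_time k r, iterated_comp H k y)"
    if "k \<ge> 1" "r \<in> {t k<..t (Suc k)}" for k r
    using infinite_concat_later[OF t_mono_on, of "Suc k" r H h_inf y] t_less_1 that by simp
  show ?thesis
  proof (cases "s = t n")
    case True
    have lt: "t m < t n"
      using Suc strict_monoD[OF t_strict_mono, of m n] by simp
    have "F (s, y) = H (Suc m) (stage_time m s, iterated_comp H m y)"
    proof (cases m)
      case 0
      then show ?thesis
        using infinite_concat_first[of t s H h_inf y] True Suc t_less_1[of 1] t0 t_nonneg[of 1]
        by simp
    next
      case (Suc k)
      then show ?thesis
        using later[of m s] True \<open>n = Suc m\<close> lt by simp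
    qed
    also have "\<dots> = iterated_comp H n y"
      using True Suc lt by (simp add: end_map_def)
    also have "\<dots> = H (Suc n) (stage_time n s, iterated_comp H n y)"
      using iso[of "Suc n"] True by (simp add: isotopy_def)
    finally show ?thesis .
  next
    case False
    then show ?thesis
      using later[of n s] Suc assms by simp
  qed
qed

lemma F_at_t: "F (t n, y) = iterated_comp H n y"
  using F_stage[of "t n" n y] iso[of "Suc n"] strict_monoD[OF t_strict_mono, of n "Suc n"]
  by (simp add: isotopy_def)

lemma stage_exists:
  assumes "0 \<le> s" and "s < 1"
  obtains n where "s \<in> {t n..t (Suc n)}"
proof -
  define n where "n = (LEAST k. s < t (Suc k))"
  have "eventually (\<lambda>k. s < t k) sequentially"
    using order_tendstoD(1)[OF t_lim assms(2)] .
  then obtain N where "\<And>k. k \<ge> N \<Longrightarrow> s < t k"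
    unfolding eventually_sequentially by blast
  then have "s < t (Suc N)"
    by simp
  then have "s < t (Suc n)"
    unfolding n_def by (rule LeastI)
  moreover have "t n \<le> s"
  proof (cases n)
    case 0
    then show ?thesis using assms t0 by simp
  next
    case (Suc m)
    then have "\<not> s < t (Suc m)"
      using not_less_Least[of m "\<lambda>k. s < t (Suc k)"] unfolding n_def by linarith
    then show ?thesis using Suc by simp
  qed
  ultimately show ?thesis
    using that[of n] by simp
qed

lemma comp_homeomorphism: "\<exists>g. homeomorphism UNIV UNIV (iterated_comp H n) g"
  by (rule iterated_comp_homeomorphism) (rule iso)

lemma iterated_comp_continuous: "continuous_on S (iterated_comp H n)"
proof -
  have "continuous_on UNIV (iterated_comp H n)"
    using comp_homeomorphism[of n] unfolding homeomorphism_def by blast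
  then show ?thesis
    by (rule continuous_on_subset) simp
qed

lemma F_continuous_stage: "continuous_on ({t n..t (Suc n)} \<times> UNIV) F"
proof -
  have "continuous_on ({t n..t (Suc n)} \<times> UNIV)
    (\<lambda>p. H (Suc n) (stage_time n (fst p), iterated_comp H n (snd p)))"
  proof (rule continuous_on_compose2[of "{0..1} \<times> UNIV" "H (Suc n)"])
    show "continuous_on ({0..1} \<times> UNIV) (H (Suc n))"
      using iso[of "Suc n"] by (simp add: isotopy_def)
    have "continuous_on ({t n..t (Suc n)} \<times> UNIV) (\<lambda>p. iterated_comp H n (snd p))"
      by (rule continuous_on_compose2[OF iterated_comp_continuous[of UNIV n]])
        (auto intro!: continuous_on_snd continuous_on_id)
    then show "continuous_on ({t n..t (Suc n)} \<times> UNIV)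
      (\<lambda>p. (stage_time n (fst p), iterated_comp H n (snd p)))"
      using strict_monoD[OF t_strict_mono, of n "Suc n"] by (intro continuous_intros) auto
    show "(\<lambda>p. (stage_time n (fst p), iterated_comp H n (snd p))) ` ({t n..t (Suc n)} \<times> UNIV)
      \<subseteq> {0..1} \<times> UNIV"
      using stage_time_range by fastforce
  qed
  then show ?thesis
    by (rule continuous_on_eq) (auto simp: F_stage)
qed

lemma F_continuous_before: "continuous_on ({0..t n} \<times> UNIV) F"
proof (induction n)
  case 0
  show ?case
    by (rule continuous_on_subset[OF F_continuous_stage[of 0]])
      (use t0 t_nonneg[of 1] in auto)
next
  case (Suc n)
  have "{0..t (Suc n)} \<times> (UNIV::'a set) = {0..t n} \<times> UNIV \<union> {t n..t (Suc n)} \<times> UNIV"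
    using t_nonneg[of n] strict_monoD[OF t_strict_mono, of n "Suc n"] by auto
  then show ?case
    using Suc F_continuous_stage[of n] by (simp add: continuous_on_closed_Un closed_Times)
qed

lemma dist_after_stage:
  assumes "t n \<le> s" and "s \<le> 1"
  shows "dist (iterated_comp H n y) (F (s, y)) \<le> diameter (\<Union>k\<in>{Suc n..}. V k)"
proof -
  let ?W = "\<Union>k\<in>{Suc n..}. V k"
  have "?W \<subseteq> (\<Union>k\<in>{1..}. V k)"
    by (rule UN_mono) auto
  then have "?W \<subseteq> A"
    using V_A interior_subset[of A] by blast
  then have bounded: "bounded ?W"
    using compact compact_imp_bounded bounded_subset by blast
  have bound: "dist (iterated_comp H n y) (H (Suc m) (r, iterated_comp H m y)) \<le> diameter ?W"
    if "n \<le> m" "r \<in> {0..1}" for m r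
    using later_motion_trapped[of H V n m r y, OF iso supp that]
      diameter_bounded_bound[OF bounded] diameter_ge_0[OF bounded] by force
  show ?thesis
  proof (cases "s = 1")
    case True
    have "dist (iterated_comp H n y) (iterated_comp H m y) \<le> diameter ?W" if "n \<le> m" for m
      using bound[OF that, of 0] iso[of "Suc m"] by (simp add: isotopy_def)
    then have "dist (iterated_comp H n y) (h_inf y) \<le> diameter ?W"
      by (intro LIMSEQ_le_const2[OF tendsto_dist[OF tendsto_const lim]]) blast
    then show ?thesis
      using True by (simp add: infinite_concat_end)
  next
    case False
    \<comment> \<open>At \<open>s = t n\<close> the chosen stage could be the one that ends there, which starts too early for the bound.\<close>
    show ?thesis
    proof (cases "s = t n")
      case True
      then show ?thesis
        using F_at_t diameter_ge_0[OF bounded] by simp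
    next
      case neq: False
      obtain m where m: "s \<in> {t m..t (Suc m)}"
        using stage_exists[of s] False assms t_nonneg[of n] by auto
      then have "t n < t (Suc m)"
        using assms neq by auto
      then have "n \<le> m"
        using strict_mono_less[OF t_strict_mono] by simp
      then show ?thesis
        using bound[of m "stage_time m s"] stage_time_range[OF m] F_stage[OF m] by simp
    qed
  qed
qed

text \<open>
  The stopped maps converge uniformly: stopping at \<open>t n\<close> changes nothing before \<open>t n\<close>, and later the error
  is at most the diameter of the union of the remaining supports.
\<close>

lemma F_continuous: "continuous_on ({0..1} \<times> UNIV) F"
proof (rule uniform_limit_theorem)
  let ?G = "\<lambda>n p. F (min (fst p) (t n), snd p)"
  show "\<forall>\<^sub>F n in sequentially. continuous_on ({0..1} \<times> UNIV) (?G n)"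
  proof (intro always_eventually allI)
    fix n
    show "continuous_on ({0..1} \<times> UNIV) (?G n)"
      by (rule continuous_on_compose2[OF F_continuous_before[of n]])
        (auto intro!: continuous_intros simp: t_nonneg)
  qed
  show "uniform_limit ({0..1} \<times> UNIV) ?G F sequentially"
  proof (rule uniform_limitI)
    fix e :: real
    assume "e > 0"
    have "\<forall>\<^sub>F n in sequentially. diameter (\<Union>k\<in>{Suc n..}. V k) < e"
      using order_tendstoD(2)[OF LIMSEQ_Suc[OF diam] \<open>e > 0\<close>] .
    then show "\<forall>\<^sub>F n in sequentially. \<forall>p\<in>{0..1} \<times> UNIV. dist (?G n p) (F p) < e"
    proof eventually_elim
      case (elim n)
      show ?case
      proof
        fix p :: "real \<times> 'a"
        assume p: "p \<in> {0..1} \<times> UNIV"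
        show "dist (?G n p) (F p) < e"
        proof (cases "fst p \<le> t n")
          case True
          then show ?thesis using \<open>e > 0\<close> by simp
        next
          case False
          then show ?thesis
            using dist_after_stage[of n "fst p" "snd p"] p elim by (auto simp: F_at_t)
        qed
      qed
    qed
  qed
qed simp

lemma h_inf_homeomorphism: "homeomorphism UNIV UNIV h_inf (inv h_inf)"
proof (rule homeomorphism_if_identity_off_compact[OF _ bij compact])
  have "continuous_on UNIV (\<lambda>y. F (1, y))"
    by (rule continuous_on_compose2[OF F_continuous]) (auto intro!: continuous_intros)
  then show "continuous_on UNIV h_inf"
    by (simp add: infinite_concat_end)
next
  fix y
  assume y: "y \<notin> interior A"
  have "iterated_comp H n y = y" for n
  proof (induction n)
    case (Suc n)
    have "y \<notin> V (Suc n)"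
      using y V_A by auto
    then show ?case
      using Suc supp[of "Suc n" 1 y] by (simp add: end_map_def)
  qed simp
  then show "h_inf y = y"
    using lim[of y] by (simp add: LIMSEQ_const_iff)
qed

lemma F_homeomorphism:
  assumes "s \<in> {0..1}"
  shows "\<exists>g. homeomorphism UNIV UNIV (\<lambda>y. F (s, y)) g"
proof (cases "s = 1")
  case True
  then show ?thesis
    using h_inf_homeomorphism by (auto simp: infinite_concat_end)
next
  case False
  then obtain n where n: "s \<in> {t n..t (Suc n)}"
    using stage_exists[of s] assms by auto
  obtain g where "homeomorphism UNIV UNIV (iterated_comp H n) g"
    using comp_homeomorphism by blast
  moreover obtain g' where "homeomorphism UNIV UNIV (\<lambda>y. H (Suc n) (stage_time n s, y)) g'"
    using iso[of "Suc n", simplified] stage_time_range[OF n] unfolding isotopy_def by blast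
  ultimately show ?thesis
    using homeomorphism_compose F_stage[OF n] by (fastforce simp: o_def)
qed

lemma isotopy_F: "isotopy F"
  unfolding isotopy_def
  using F_continuous F_homeomorphism F_at_t[of 0] t0 by simp

end

theorem theorem3p8:
  fixes H :: "nat \<Rightarrow> real \<times> 'a \<Rightarrow> 'a::metric_space"
    and V :: "nat \<Rightarrow> 'a set"
    and h_inf :: "'a \<Rightarrow> 'a"
    and t :: "nat \<Rightarrow> real"
  assumes "\<And>k. k \<ge> 1 \<Longrightarrow> isotopy (H k)"
    and "\<And>k s y. k \<ge> 1 \<Longrightarrow> s \<in> {0..1} \<Longrightarrow> y \<notin> V k \<Longrightarrow> H k (s, y) = y"
    and "(\<lambda>n. diameter (\<Union>k\<in>{n..}. V k)) \<longlonglongrightarrow> 0"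
    and "\<exists>A. compact A \<and> (\<Union>k\<in>{1..}. V k) \<subseteq> interior A"
    and "\<And>y. (\<lambda>n. iterated_comp H n y) \<longlonglongrightarrow> h_inf y"
    and "bij h_inf"
    and "t 0 = 0"
    and "strict_mono_on {1..} t"
    and "\<And>k. k \<ge> 1 \<Longrightarrow> t k \<in> {0<..<1}"
    and "t \<longlonglongrightarrow> 1"
  shows "isotopy (infinite_concat t H h_inf)"
proof -
  obtain A where "compact A" "(\<Union>k\<in>{1..}. V k) \<subseteq> interior A"
    using assms(4) by blast
  with assms interpret isotopy_sequence H V h_inf t A
    by unfold_locales
  show ?thesis
    by (rule isotopy_F)
qed

end
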